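(* Let $p$ be an odd prime, let $s,h,t,r$ be positive integers with $t\mid h$, $s\le h$, $\gcd(r,p)=1$, and let $q=p^h$. Assume that $\mathbb{F}_q$ is the splitting field of $g(x)=x^{2rp^s}+bx^{2rp^s-1}+c$ ($b,c\ne0$) over $\mathbb{F}_{p^t}$, that $\alpha_1,\dots,\alpha_{2rp^s}$ are all the roots of $g(x)$, and let $v_i=\alpha_i^{1-rp^s}$ for $1\le i\le2rp^s$. Let $\boldsymbol{\alpha}=(\alpha_1,\dots,\alpha_{2rp^s})$ and $\boldsymbol{v}=(v_1,\dots,v_{2rp^s})$. Let $\eta_{12},\eta_{22}\in\mathbb{F}_q^*$ and $\eta_{i1}=\frac b2\eta_{i2}$ for $i=1,2$. Set $$\mathcal{S}_1=\Big\{\sum_{i=0}^{rp^s-2}f_ix^i+\sum_{i=1}^2f_{rp^s-4+i}\,\eta_{i2}\Big(\frac b2x^{rp^s-1}+x^{rp^s}\Big): f_i\in\mathbb{F}_q\text{ for }0\le i\le rp^s-2\Big\}.$$ Then $\mathcal{C}_1=ev_{\boldsymbol{\alpha},\boldsymbol{v}}(\mathcal{S}_1)$ is a $[2rp^s,\,rp^s-1,\,\ge rp^s]$ self-orthogonal TGRS code over $\mathbb{F}_q$.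
   Context: Here $b,c\in\mathbb{F}_{p^t}$. For $\boldsymbol{\alpha}\in\mathbb{F}^n$ with distinct entries and $\boldsymbol{v}\in(\mathbb{F}^* )^n$ ($\mathbb{F}$ a finite field), $ev_{\boldsymbol{\alpha},\boldsymbol{v}}(f)=(v_1f(\alpha_1),\dots,v_nf(\alpha_n))$ for $f\in\mathbb{F}[x]$. For a $k\times(n-k)$ matrix $(\eta_{ij})$ over $\mathbb{F}$, the twisted generalized Reed-Solomon (TGRS) code is the image under $ev_{\boldsymbol{\alpha},\boldsymbol{v}}$ of $\{\sum_{i=0}^{k-1}f_ix^i+\sum_{i=0}^{k-1}f_i\sum_{j=1}^{n-k}\eta_{i+1,j}x^{k-1+j}:f_i\in\mathbb{F}\}$. A linear code is $[n,k,\ge d]$ if it has length $n$, dimension $k$ and minimum Hamming distance at least $d$. It is self-orthogonal if $\mathcal{C}\subseteq\mathcal{C}^\perp$ for the Euclidean inner product. *)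

theory Defs
  imports "HOL-Algebra.Algebraic_Closure_Type" "HOL-Algebra.Generated_Fields" "HOL-Analysis.Analysis"
begin

text \<open>
  A finite field is a type of sort \<open>{field, finite}\<close>, and its subfields are sets. The carrier-based
  notions \<open>subfield\<close> and \<open>generate_field\<close> of HOL-Algebra are used through the record
  \<open>ring_of_type_algebra\<close>. Words of length \<open>n\<close> are vectors \<open>'a ^ 'n\<close> with \<open>CARD('n) = n\<close>.
\<close>

text \<open>The full type \<open>'a\<close> is a splitting field of \<open>g\<close> over its subfield \<open>K\<close>.\<close>

definition is_splitting_field :: "'a::field set \<Rightarrow> 'a poly \<Rightarrow> bool" where
  "is_splitting_field K g \<longleftrightarrow>
     subfield K ring_of_type_algebra \<and> g \<noteq> 0 \<and> set (coeffs g) \<subseteq> K \<and>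
     (\<exists>rs. g = smult (lead_coeff g) (\<Prod>x\<leftarrow>rs. [:- x, 1:])) \<and>
     generate_field ring_of_type_algebra (K \<union> {x. poly g x = 0}) = UNIV"

definition ev :: "'a::field ^ 'n \<Rightarrow> 'a ^ 'n \<Rightarrow> 'a poly \<Rightarrow> 'a ^ 'n" where
  "ev \<alpha> v f = (\<chi> i. v $ i * poly f (\<alpha> $ i))"

definition hamming_dist :: "'a ^ 'n \<Rightarrow> 'a ^ 'n \<Rightarrow> nat" where
  "hamming_dist x y = card {i. x $ i \<noteq> y $ i}"

text \<open>The value of \<open>min_distance\<close> is unspecified for codes with fewer than two words.\<close>

definition min_distance :: "('a ^ 'n) set \<Rightarrow> nat" where
  "min_distance C = Min {hamming_dist x y | x y. x \<in> C \<and> y \<in> C \<and> x \<noteq> y}"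

text \<open>\<open>C\<close> is an \<open>[n, k, \<ge>d]\<close> linear code.\<close>

definition is_linear_code :: "nat \<Rightarrow> nat \<Rightarrow> nat \<Rightarrow> ('a::field ^ 'n) set \<Rightarrow> bool" where
  "is_linear_code n k d C \<longleftrightarrow>
     CARD('n) = n \<and> vec.subspace C \<and> vec.dim C = k \<and> min_distance C \<ge> d"

definition dual_code :: "('a::field ^ 'n) set \<Rightarrow> ('a ^ 'n) set" where
  "dual_code C = {y. \<forall>x\<in>C. scalar_product x y = 0}"

definition self_orthogonal :: "('a::field ^ 'n) set \<Rightarrow> bool" where
  "self_orthogonal C \<longleftrightarrow> C \<subseteq> dual_code C"

text \<open>
  Only the entries \<open>\<eta> i j\<close> with \<open>1 \<le> i \<le> k\<close> and \<open>1 \<le> j \<le> n - k\<close> of the coefficient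
  matrix are used; the coefficients \<open>f i\<close> are indexed from \<open>0\<close>.
\<close>

definition tgrs_polys :: "nat \<Rightarrow> nat \<Rightarrow> (nat \<Rightarrow> nat \<Rightarrow> 'a::field) \<Rightarrow> 'a poly set" where
  "tgrs_polys n k \<eta> =
     {(\<Sum>i<k. monom (f i) i) +
      (\<Sum>i<k. smult (f i) (\<Sum>j=1..n - k. monom (\<eta> (i + 1) j) (k - 1 + j))) | f. True}"

definition is_tgrs_code :: "'a::field ^ 'n \<Rightarrow> 'a ^ 'n \<Rightarrow> nat \<Rightarrow> ('a ^ 'n) set \<Rightarrow> bool" where
  "is_tgrs_code \<alpha> v k C \<longleftrightarrow>
     inj (($) \<alpha>) \<and> (\<forall>i. v $ i \<noteq> 0) \<and> 1 \<le> k \<and> k \<le> CARD('n) \<and>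
     (\<exists>\<eta>. C = ev \<alpha> v ` tgrs_polys CARD('n) k \<eta>)"

end

theory Submission
  imports Defs "HOL-Number_Theory.Residues"
begin

text \<open>
  Put \<open>m = r p\<^sup>s\<close>, so that \<open>g\<close> has degree \<open>2m\<close>. As \<open>p\<close> divides \<open>m\<close>, the derivative of \<open>g\<close> is
  \<open>- b x\<^sup>2\<^sup>m\<^sup>-\<^sup>2\<close>; hence \<open>g\<close> has \<open>2m\<close> distinct roots and \<open>v\<^sub>i\<^sup>2 = - b / g'(\<alpha>\<^sub>i)\<close>. By Lagrange interpolation
  at the roots of \<open>g\<close>, the inner product of the words of \<open>f\<^sub>1\<close> and \<open>f\<^sub>2\<close> is \<open>- b\<close> times the
  coefficient of \<open>x\<^sup>2\<^sup>m\<^sup>-\<^sup>1\<close> in \<open>f\<^sub>1 f\<^sub>2\<close> reduced modulo \<open>g\<close>. The twist \<open>b/2 x\<^sup>m\<^sup>-\<^sup>1 + x\<^sup>m\<close> is chosen such that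
  this coefficient vanishes: \<open>f\<^sub>1 f\<^sub>2\<close> has leading terms \<open>e (x\<^sup>2\<^sup>m + b x\<^sup>2\<^sup>m\<^sup>-\<^sup>1)\<close>, just as \<open>e g\<close> has.
  Dimension and distance follow because the polynomials have degree at most \<open>m\<close>.
\<close>

lemma CHAR_eq_prime:
  assumes "prime p" "CARD('a::{field, finite}) = p ^ h"
  shows "CHAR('a) = p"
proof -
  have pr: "prime CHAR('a)"
    by (intro prime_CHAR_semidom finite_imp_CHAR_pos) auto
  have "CHAR('a) dvd p ^ h"
    using CHAR_dvd_CARD[where 'a = 'a] assms(2) by simp
  then show ?thesis
    using pr assms(1) by (metis prime_dvd_power primes_dvd_imp_eq)
qed

text \<open>The product rule gives one summand per omitted factor; at \<open>a\<close> only the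
  summand without the factor of \<open>a\<close> survives.\<close>

lemma poly_pderiv_prod_linear:
  fixes A :: "'a::field set"
  assumes "finite A" "a \<in> A"
  shows "poly (pderiv (\<Prod>x\<in>A. [:- x, 1:])) a = poly (\<Prod>x\<in>A - {a}. [:- x, 1:]) a"
proof -
  have "poly (pderiv (\<Prod>x\<in>A. [:- x, 1:])) a = (\<Sum>y\<in>A. poly (\<Prod>x\<in>A - {y}. [:- x, 1:]) a)"
    by (simp add: pderiv_prod poly_sum pderiv_pCons)
  also have "\<dots> = poly (\<Prod>x\<in>A - {a}. [:- x, 1:]) a + (\<Sum>y\<in>A - {a}. poly (\<Prod>x\<in>A - {y}. [:- x, 1:]) a)"
    using assms by (rule sum.remove)
  also have "(\<Sum>y\<in>A - {a}. poly (\<Prod>x\<in>A - {y}. [:- x, 1:]) a) = 0"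
    using assms by (intro sum.neutral) (auto simp: poly_prod)
  finally show ?thesis by simp
qed

lemma degree_prod_linear:
  fixes A :: "'a::field set"
  shows "degree (\<Prod>x\<in>A. [:- x, 1:]) = card A"
  by (subst degree_prod_eq_sum_degree) auto

lemma coeff_prod_linear_card:
  fixes A :: "'a::field set"
  shows "coeff (\<Prod>x\<in>A. [:- x, 1:]) (card A) = 1"
  using lead_coeff_prod[of "\<lambda>x. [:- x, 1:]" A] by (simp add: degree_prod_linear)

text \<open>Subtracting \<open>coeff f (card A)\<close> times the monic \<open>G\<close> keeps the
  values of \<open>f\<close> on \<open>A\<close> and lowers the degree below \<open>card A\<close>.
  The remainder equals its Lagrange interpolant, whose basis polynomials are monic of degree
  \<open>card A - 1\<close> up to the scalars summed on the left; comparing coefficients there gives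
  the formula.\<close>

lemma sum_poly_div_pderiv:
  fixes A :: "'a::field set"
  defines "G \<equiv> \<Prod>x\<in>A. [:- x, 1:]"
  assumes "finite A" "A \<noteq> {}" and deg: "degree f \<le> card A"
  shows "(\<Sum>a\<in>A. poly f a / poly (pderiv G) a) =
    coeff f (card A - 1) - coeff f (card A) * coeff G (card A - 1)"
proof -
  define n where "n = card A"
  have n: "n > 0" using assms by (simp add: n_def card_gt_0_iff)
  define L where "L a = (\<Prod>x\<in>A - {a}. [:- x, 1:])" for a
  have degL: "degree (L a) = n - 1" and coeffL: "coeff (L a) (n - 1) = 1" if "a \<in> A" for a
    using that assms degree_prod_linear[of "A - {a}"] coeff_prod_linear_card[of "A - {a}"]
    by (auto simp: L_def n_def)
  have L0: "poly (L a) y = 0" if "y \<in> A" "y \<noteq> a" for a y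
    using that assms by (auto simp: L_def poly_prod)
  have w: "poly (pderiv G) a = poly (L a) a" if "a \<in> A" for a
    using poly_pderiv_prod_linear[OF \<open>finite A\<close> that] by (simp add: G_def L_def)
  have Lnz: "poly (L a) a \<noteq> 0" for a
    using assms by (auto simp: L_def poly_prod)
  define u where "u a = poly f a / poly (pderiv G) a" for a
  \<comment> \<open>The remainder minus its interpolant: degree below \<open>n\<close> and
    \<open>n\<close> zeros force \<open>D = 0\<close>.\<close>
  define D where "D = f - smult (coeff f n) G - (\<Sum>a\<in>A. smult (u a) (L a))"
  have "coeff D i = 0" if "i \<ge> n" for i
  proof -
    have "coeff (L a) i = 0" if "a \<in> A" for a
      using degL[OF that] n \<open>i \<ge> n\<close> by (intro coeff_eq_0) simp
    then have *: "coeff D i = coeff f i - coeff f n * coeff G i"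
      by (simp add: D_def coeff_sum)
    show ?thesis
    proof (cases "i = n")
      case True
      then show ?thesis using * coeff_prod_linear_card[of A] by (simp add: G_def n_def)
    next
      case False
      then have "coeff f i = 0" "coeff G i = 0"
        using deg that degree_prod_linear[of A] by (auto intro!: coeff_eq_0 simp: G_def n_def)
      then show ?thesis using * by simp
    qed
  qed
  then have degD: "degree D < n"
    using n by (intro degree_lessI) auto
  have "poly D y = 0" if "y \<in> A" for y
  proof -
    have "(\<Sum>a\<in>A. u a * poly (L a) y) = u y * poly (L y) y + (\<Sum>a\<in>A - {y}. u a * poly (L a) y)"
      using \<open>finite A\<close> that by (rule sum.remove)
    also have "(\<Sum>a\<in>A - {y}. u a * poly (L a) y) = 0"
      using that by (intro sum.neutral) (auto intro: L0)
    also have "u y * poly (L y) y = poly f y"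
      using w[OF that] Lnz[of y] by (simp add: u_def)
    finally show ?thesis
      using that assms by (auto simp: D_def poly_sum G_def poly_prod)
  qed
  then have "A \<subseteq> {y. poly D y = 0}" by auto
  have "D = 0"
  proof (rule ccontr)
    assume "D \<noteq> 0"
    then have "n \<le> degree D"
      using card_mono[OF poly_roots_finite \<open>A \<subseteq> {y. poly D y = 0}\<close>] card_poly_roots_bound[of D]
      by (simp add: n_def)
    with degD show False by simp
  qed
  then have "0 = coeff D (n - 1)" by simp
  also have "\<dots> = coeff f (n - 1) - coeff f n * coeff G (n - 1) - (\<Sum>a\<in>A. u a)"
    by (simp add: D_def coeff_sum coeffL del: One_nat_def)
  finally show ?thesis by (simp add: u_def n_def)
qed

text \<open>A repeated entry of \<open>rs\<close> would be a double root, at which the derivative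
  vanishes too.\<close>

lemma split_separable_eq_prod:
  fixes f :: "'a::field poly"
  assumes split: "f = (\<Prod>x\<leftarrow>rs. [:- x, 1:])"
    and sep: "\<And>x. poly f x = 0 \<Longrightarrow> poly (pderiv f) x \<noteq> 0"
  shows "f = (\<Prod>x | poly f x = 0. [:- x, 1:])"
proof -
  have "distinct rs"
  proof (rule ccontr)
    assume "\<not> distinct rs"
    then obtain xs ys zs x where "rs = xs @ [x] @ ys @ [x] @ zs"
      using not_distinct_decomp by blast
    then obtain k where "f = [:- x, 1:] * ([:- x, 1:] * k)"
      using split by (simp add: mult.left_commute del: mult_pCons_left)
    then have "poly f x = 0" "poly (pderiv f) x = 0"
      by (simp_all add: pderiv_mult del: mult_pCons_left)
    with sep show False by blast
  qed
  moreover have "{x. poly f x = 0} = set rs"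
    unfolding split by (induction rs) auto
  ultimately show ?thesis
    using split by (simp add: prod.distinct_set_conv_list)
qed

text \<open>\<open>vec.independent\<close> speaks of sets, so the family must first be seen to be
  injective: two equal members would give a nontrivial relation, against
  \<open>indep\<close>.\<close>

lemma dim_family:
  fixes w :: "nat \<Rightarrow> 'a::field ^ 'n"
  assumes indep: "\<And>u i. (\<Sum>i<k. u i *s w i) = 0 \<Longrightarrow> i < k \<Longrightarrow> u i = 0"
  defines "C \<equiv> {\<Sum>i<k. u i *s w i | u. True}"
  shows "vec.subspace C" "vec.dim C = k"
proof -
  have inj: "inj_on w {..<k}"
  proof (rule inj_onI, rule ccontr)
    fix i j assume ij: "i \<in> {..<k}" "j \<in> {..<k}" "w i = w j" "i \<noteq> j"
    let ?u = "\<lambda>l. (if l = i then 1 else 0) - (if l = j then 1 else 0 :: 'a)"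
    have "(\<Sum>l<k. ?u l *s w l) = 0"
      using ij by (simp add: vec.scale_left_diff_distrib sum_subtractf if_distrib[of "\<lambda>x. x *s _"] cong: if_cong)
    from indep[OF this, of i] ij show False by simp
  qed
  have reindex: "(\<Sum>y\<in>w ` {..<k}. z y *s y) = (\<Sum>i<k. z (w i) *s w i)" for z
    by (subst sum.reindex[OF inj]) simp
  have "vec.independent (w ` {..<k})"
  proof (rule vec.independent_if_scalars_zero)
    fix z x assume "(\<Sum>y\<in>w ` {..<k}. z y *s y) = 0" "x \<in> w ` {..<k}"
    then show "z x = 0"
      using indep[of "\<lambda>i. z (w i)"] by (auto simp: reindex)
  qed simp
  moreover have "C = vec.span (w ` {..<k})"
  proof -
    have "\<exists>z. (\<Sum>i<k. u i *s w i) = (\<Sum>i<k. z (w i) *s w i)" for u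
      by (intro exI[of _ "\<lambda>y. u (inv_into {..<k} w y)"] sum.cong) (simp_all add: inv_into_f_f[OF inj])
    then show ?thesis
      by (auto simp: C_def vec.span_finite reindex)
  qed
  ultimately show "vec.subspace C" "vec.dim C = k"
    using card_image[OF inj] by (simp_all add: vec.dim_eq_card_independent)
qed

text \<open>By linearity distances are weights of differences. The nonzero word \<open>x\<close>
  keeps the set under \<open>Min\<close> nonempty, where \<open>Min\<close> is meaningful.\<close>

lemma min_distance_ge:
  fixes C :: "('a::{field, finite} ^ 'n) set"
  assumes C: "vec.subspace C" and ne: "x \<in> C" "x \<noteq> 0"
    and weight: "\<And>x. x \<in> C \<Longrightarrow> x \<noteq> 0 \<Longrightarrow> d \<le> card {i. x $ i \<noteq> 0}"
  shows "d \<le> min_distance C"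
proof -
  let ?D = "{hamming_dist x y | x y. x \<in> C \<and> y \<in> C \<and> x \<noteq> y}"
  have "?D \<subseteq> {..CARD('n)}" by (auto simp: hamming_dist_def intro!: card_mono)
  then have "finite ?D" by (rule finite_subset) simp
  moreover have "hamming_dist x 0 \<in> ?D"
    using ne vec.subspace_0[OF C] by blast
  moreover have "d \<le> hamming_dist y z" if "y \<in> C" "z \<in> C" "y \<noteq> z" for y z
    using weight[of "y - z"] vec.subspace_diff[OF C that(1,2)] that(3)
    by (simp add: hamming_dist_def)
  ultimately show ?thesis
    unfolding min_distance_def by (intro Min.boundedI) auto
qed

lemma ev_sum_smult:
  "ev \<alpha> v (\<Sum>i\<in>I. smult (u i) (E i)) = (\<Sum>i\<in>I. u i *s ev \<alpha> v (E i))"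
  by (simp add: ev_def vec_eq_iff poly_sum sum_distrib_left mult_ac)

theorem theorem27:
  fixes p s h t r :: nat
    and K :: "'a::{field, finite} set"
    and b c :: 'a
    and g :: "'a poly"
    and \<alpha> v :: "'a ^ 'n"
    and \<eta> :: "nat \<Rightarrow> nat \<Rightarrow> 'a"
    and S1 :: "'a poly set"
    and C1 :: "('a ^ 'n) set"
  assumes "prime p" and "odd p"
    and "s > 0" and "h > 0" and "t > 0" and "r > 0"
    and "t dvd h" and "s \<le> h" and "coprime r p"
    and "CARD('a) = p ^ h"
    and "card K = p ^ t"
    and "b \<in> K" and "c \<in> K" and "b \<noteq> 0" and "c \<noteq> 0"
    and "g = monom 1 (2 * r * p ^ s) + monom b (2 * r * p ^ s - 1) + monom c 0"
    and "is_splitting_field K g"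
    and "CARD('n) = 2 * r * p ^ s"
    and "range (($) \<alpha>) = {x. poly g x = 0}"
    and "\<forall>i. v $ i = (\<alpha> $ i) powi (1 - int (r * p ^ s))"
    and "\<eta> 1 2 \<noteq> 0" and "\<eta> 2 2 \<noteq> 0"
    and "\<forall>i\<in>{1, 2}. \<eta> i 1 = b / 2 * \<eta> i 2"
    and "S1 = {(\<Sum>i=0..r * p ^ s - 2. monom (f i) i) +
               (\<Sum>i=1..2. smult (f (r * p ^ s + i - 4) * \<eta> i 2)
                  (monom (b / 2) (r * p ^ s - 1) + monom 1 (r * p ^ s))) | f. True}"
    and "C1 = ev \<alpha> v ` S1"
  shows "is_linear_code (2 * r * p ^ s) (r * p ^ s - 1) (r * p ^ s) C1 \<and>
         self_orthogonal C1 \<and>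
         is_tgrs_code \<alpha> v (r * p ^ s - 1) C1"
proof -
  note pr = assms(1) and odd_p = assms(2) and g = assms(16) and S1 = assms(24) and C1 = assms(25)
  define m where "m = r * p ^ s"
  have "3 \<le> p"
    using pr odd_p prime_ge_2_nat[OF pr] by (cases "p = 2") auto
  also have "p \<le> p ^ s"
    using \<open>s > 0\<close> prime_gt_0_nat[OF pr] by (simp add: self_le_power)
  also have "p ^ s \<le> m"
    using \<open>r > 0\<close> by (simp add: m_def)
  \<comment> \<open>With \<open>m = l + 3\<close> the truncated subtractions become additions, and
    \<open>l\<close>, \<open>l + 1\<close> are the indices of the two coefficients feeding the
    twist.\<close>
  finally obtain l where l: "m = l + 3"
    using le_iff_add[of 3 m] by (auto simp: add.commute)
  have n: "CARD('n) = 2 * m" "2 * r * p ^ s = 2 * m"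
    using assms(18) by (simp_all add: m_def)

  \<comment> \<open>The characteristic and the roots of \<open>g\<close>\<close>
  have char: "CHAR('a) = p"
    using pr assms(10) by (rule CHAR_eq_prime)
  have m0: "of_nat m = (0 :: 'a)"
    using \<open>s > 0\<close> by (simp add: of_nat_eq_0_iff_char_dvd char m_def dvd_power)
  have two: "(2 :: 'a) \<noteq> 0"
  proof
    assume "(2 :: 'a) = 0"
    then have "of_nat 2 = (0 :: 'a)" by simp
    then have "p dvd 2" unfolding of_nat_eq_0_iff_char_dvd char .
    with \<open>3 \<le> p\<close> show False by (auto dest: dvd_imp_le)
  qed

  have g': "g = monom 1 (2 * m) + monom b (2 * m - 1) + monom c 0"
    using g by (simp add: n)
  have coeff_g: "coeff g (2 * m) = 1" "coeff g (2 * m - 1) = b"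
    using l by (simp_all add: g')
  have deg_g: "degree g = 2 * m"
  proof (rule antisym)
    show "degree g \<le> 2 * m"
      unfolding g' by (intro degree_le) (auto simp: l)
    show "2 * m \<le> degree g"
      by (rule le_degree) (simp add: coeff_g)
  qed
  have "of_nat (2 * m) = (0 :: 'a)"
    by (simp add: m0)
  moreover from this have "of_nat (2 * m - 1) = (- 1 :: 'a)"
    by (subst of_nat_diff) (simp_all add: l del: of_nat_mult)
  ultimately have "pderiv g = monom (- b) (2 * m - 2)"
    by (simp add: g' pderiv_add pderiv_monom diff_diff_eq numeral_2_eq_2 del: of_nat_mult)
  then have pderiv_g: "poly (pderiv g) x = - b * x ^ (2 * m - 2)" for x
    by (simp add: poly_monom)
  \<comment> \<open>Nonzero roots serve twice: \<open>pderiv g\<close> does not vanish at them, and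
    the multipliers \<open>v $ i\<close> are nonzero.\<close>
  have root_nz: "x \<noteq> 0" if "poly g x = 0" for x
    using that l \<open>c \<noteq> 0\<close> by (auto simp: g' poly_monom power_0_left)
  define A where "A = {x. poly g x = 0}"
  have g_prod: "g = (\<Prod>x\<in>A. [:- x, 1:])"
  proof -
    obtain rs where "g = smult (lead_coeff g) (\<Prod>x\<leftarrow>rs. [:- x, 1:])"
      using assms(17) by (auto simp: is_splitting_field_def)
    then have "g = (\<Prod>x\<leftarrow>rs. [:- x, 1:])"
      by (simp add: deg_g coeff_g)
    then show ?thesis
      unfolding A_def by (rule split_separable_eq_prod) (simp add: pderiv_g root_nz \<open>b \<noteq> 0\<close>)
  qed
  then have card_A: "card A = 2 * m"
    using deg_g degree_prod_linear[of A] by simp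
  have range: "range (($) \<alpha>) = A"
    using assms(19) by (simp add: A_def)
  \<comment> \<open>As many positions as roots, and every root is hit.\<close>
  have inj: "inj (($) \<alpha>)"
    by (rule eq_card_imp_inj_on) (simp_all add: range card_A n)
  have \<alpha>_nz: "\<alpha> $ i \<noteq> 0" for i
    using range root_nz by (auto simp: A_def)
  then have v_nz: "v $ i \<noteq> 0" for i
    using assms(20) by (simp add: power_int_eq_0_iff)
  have v_sq: "v $ i * v $ i = - b / poly (pderiv g) (\<alpha> $ i)" for i
  proof -
    have "1 - int (r * p ^ s) = - int (l + 2)"
      by (simp add: m_def[symmetric] l)
    then have "v $ i = inverse (\<alpha> $ i ^ (l + 2))"
      using assms(20) by (simp only: power_int_minus power_int_of_nat)
    moreover have "2 * m - 2 = (l + 2) + (l + 2)"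
      by (simp add: l)
    ultimately show ?thesis
      using \<open>b \<noteq> 0\<close> by (simp only: pderiv_g power_add[of _ "l + 2"]) (simp add: field_simps)
  qed

  \<comment> \<open>Parametrisation of \<open>S1\<close> by coefficient families\<close>
  define k where "k = m - 1"
  define T where "T = monom (b / 2) (m - 1) + monom 1 m"
  \<comment> \<open>Each \<open>u i\<close> contributes \<open>u i * \<tau> i\<close> to the
    coefficient \<open>top u\<close> of the twist \<open>T\<close>, so the \<open>E i\<close> span
    \<open>S1\<close>.\<close>
  define \<tau> where "\<tau> i = (if i = l then \<eta> 1 2 else if i = l + 1 then \<eta> 2 2 else 0)" for i
  define E where "E i = monom 1 i + smult (\<tau> i) T" for i
  define P where "P u = (\<Sum>i<k. smult (u i) (E i))" for u
  define top where "top u = (\<Sum>i<k. u i * \<tau> i)" for u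
  have P: "P u = (\<Sum>i<k. monom (u i) i) + smult (top u) T" for u
    by (simp add: P_def E_def top_def smult_add_right sum.distrib smult_sum smult_monom)
  have S1_P: "S1 = {P u | u. True}"
  proof -
    have "{0..m - 2} = {..<k}" "k = Suc (Suc l)"
      by (auto simp: k_def l)
    moreover have "(\<Sum>i=1..2. smult (u (m + i - 4) * \<eta> i 2) T) = smult (u l * \<eta> 1 2 + u (l + 1) * \<eta> 2 2) T" for u
      by (simp add: l numeral_2_eq_2 smult_add_left)
    moreover have "(\<Sum>i<l. u i * \<tau> i) = 0" for u
      by (intro sum.neutral) (simp add: \<tau>_def)
    ultimately show ?thesis
      unfolding S1 P top_def T_def[symmetric] m_def[symmetric] by (simp add: \<tau>_def)
  qed
  have coeff_P: "coeff (P u) j = (if j < k then u j else 0) + top u * coeff T j" for u j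
    by (simp add: P coeff_sum)
  have coeff_low: "coeff (P u) j = u j" if "j < k" for u j
    using that by (simp add: coeff_P T_def k_def)
  have coeff_high: "coeff (P u) j = 0" if "m < j" for u j
    using that by (auto simp: coeff_P T_def k_def)
  have coeff_top: "coeff (P u) m = top u" "coeff (P u) (m - 1) = top u * (b / 2)" for u
    using l by (simp_all add: coeff_P T_def k_def)
  have deg_P: "degree (P u) \<le> m" for u
    by (rule degree_le) (simp add: coeff_high)

  \<comment> \<open>Weights, dimension and minimum distance\<close>
  have weight: "m \<le> card {i. ev \<alpha> v f $ i \<noteq> 0}" if f: "degree f \<le> m" "f \<noteq> 0" for f
  proof -
    \<comment> \<open>A word vanishes exactly where its polynomial does, and \<open>f\<close> has at
      most \<open>m\<close> zeros among the \<open>2 * m\<close> distinct points.\<close>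
    let ?Z = "{i. poly f (\<alpha> $ i) = 0}"
    have "card ?Z = card (($) \<alpha> ` ?Z)"
      using inj by (metis card_image inj_on_subset subset_UNIV)
    also have "\<dots> \<le> card {x. poly f x = 0}"
      using f by (intro card_mono poly_roots_finite) auto
    also have "\<dots> \<le> m"
      using card_poly_roots_bound[OF f(2)] f(1) by simp
    finally have "2 * m - m \<le> card (- ?Z)"
      by (simp add: card_Diff_subset Compl_eq_Diff_UNIV n)
    also have "- ?Z = {i. ev \<alpha> v f $ i \<noteq> 0}"
      using v_nz by (auto simp: ev_def)
    finally show ?thesis by simp
  qed
  have ev_P: "ev \<alpha> v (P u) = (\<Sum>i<k. u i *s ev \<alpha> v (E i))" for u
    by (simp add: P_def ev_sum_smult)
  have ev_P_0: "P u = 0" if "ev \<alpha> v (P u) = 0" for u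
    using weight[OF deg_P, of u] that l by auto
  have C1_P: "C1 = {ev \<alpha> v (P u) | u. True}"
    by (auto simp: C1 S1_P)
  have indep: "u i = 0" if "(\<Sum>i<k. u i *s ev \<alpha> v (E i)) = 0" "i < k" for u i
    using ev_P_0[of u] that coeff_low[of i u] by (simp add: ev_P)
  have dim: "vec.subspace C1" "vec.dim C1 = k"
    unfolding C1_P ev_P by (rule dim_family, erule (1) indep)+

  have "m \<le> min_distance C1"
  proof (rule min_distance_ge)
    let ?u = "\<lambda>_. 1 :: 'a"
    show "ev \<alpha> v (P ?u) \<in> C1"
      unfolding C1_P by blast
    show "ev \<alpha> v (P ?u) \<noteq> 0"
      using indep[of ?u 0] l by (auto simp: k_def ev_P)
    fix x assume "x \<in> C1" "x \<noteq> 0"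
    then obtain u where u: "x = ev \<alpha> v (P u)"
      by (auto simp: C1_P)
    with \<open>x \<noteq> 0\<close> have "P u \<noteq> 0"
      by (auto simp: ev_def vec_eq_iff)
    then show "m \<le> card {i. x $ i \<noteq> 0}"
      unfolding u by (rule weight[OF deg_P])
  qed (rule dim(1))
  then have code: "is_linear_code (2 * m) (m - 1) m C1"
    using dim n by (simp add: is_linear_code_def k_def)

  \<comment> \<open>Self-orthogonality\<close>
  have "scalar_product (ev \<alpha> v (P u)) (ev \<alpha> v (P w)) = 0" for u w
  proof -
    let ?F = "P u * P w"
    \<comment> \<open>Both factors have degree at most \<open>m\<close>, so in such a high
      coefficient only the indices \<open>m - 1\<close> and \<open>m\<close> can matter.\<close>
    have conv: "coeff ?F j = (\<Sum>i\<in>{m - 1, m}. coeff (P u) i * coeff (P w) (j - i))"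
      if "j = 2 * m \<or> j = 2 * m - 1" for j
      unfolding coeff_mult
    proof (intro sum.mono_neutral_right ballI)
      fix i assume "i \<in> {..j} - {m - 1, m}"
      then have "m < i \<or> m < j - i"
        using that by auto
      then show "coeff (P u) i * coeff (P w) (j - i) = 0"
        by (auto simp: coeff_high)
    qed (use that l in auto)
    \<comment> \<open>For \<open>2 * m - 1\<close> both index pairs give
      \<open>top u * top w * (b / 2)\<close>; the halves add up to \<open>b\<close> since 2 is
      invertible. For \<open>2 * m\<close> only \<open>i = m\<close> survives.\<close>
    have F: "coeff ?F (2 * m) = top u * top w" "coeff ?F (2 * m - 1) = top u * top w * b"
    proof -
      have "2 * m - m = m" "2 * m - (m - 1) = m + 1" "2 * m - 1 - m = m - 1" "2 * m - 1 - (m - 1) = m"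
        "m - 1 \<noteq> m"
        using l by auto
      then show "coeff ?F (2 * m) = top u * top w" "coeff ?F (2 * m - 1) = top u * top w * b"
        using two by (simp_all add: conv coeff_top coeff_high field_simps del: One_nat_def)
    qed
    have "scalar_product (ev \<alpha> v (P u)) (ev \<alpha> v (P w)) =
        (\<Sum>i\<in>UNIV. (v $ i * v $ i) * poly ?F (\<alpha> $ i))"
      by (simp add: scalar_product_def ev_def mult_ac)
    also have "\<dots> = (\<Sum>i\<in>UNIV. - b * (poly ?F (\<alpha> $ i) / poly (pderiv g) (\<alpha> $ i)))"
      by (simp add: v_sq)
    also have "\<dots> = - b * (\<Sum>a\<in>A. poly ?F a / poly (pderiv g) a)"
      unfolding range[symmetric] by (simp add: sum.reindex[OF inj] sum_distrib_left)
    also have "(\<Sum>a\<in>A. poly ?F a / poly (pderiv g) a) =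
        coeff ?F (2 * m - 1) - coeff ?F (2 * m) * coeff g (2 * m - 1)"
    proof (rule sum_poly_div_pderiv[of A ?F, folded g_prod, unfolded card_A])
      show "finite A" "A \<noteq> {}"
        using card_A l by auto
      show "degree ?F \<le> 2 * m"
        using degree_mult_le[of "P u" "P w"] deg_P[of u] deg_P[of w] by simp
    qed
    also have "\<dots> = 0"
      by (simp add: F coeff_g del: One_nat_def)
    finally show ?thesis by simp
  qed
  then have orth: "self_orthogonal C1"
    by (auto simp: self_orthogonal_def dual_code_def C1_P)

  \<comment> \<open>A twist matrix for the code\<close>
  define \<eta>' where "\<eta>' i j = (if j = 1 then b / 2 * \<tau> (i - 1) else if j = 2 then \<tau> (i - 1) else 0)" for i j :: nat
  \<comment> \<open>Row \<open>i + 1\<close> belongs to the coefficient of index \<open>i\<close>,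
    hence the shift in \<open>\<eta>'\<close>. As \<open>k = m - 1\<close>, columns 1 and 2 sit at
    the exponents \<open>m - 1\<close> and \<open>m\<close> of \<open>T\<close>.\<close>
  have "(\<Sum>j=1..2 * m - k. monom (\<eta>' (i + 1) j) (k - 1 + j)) = smult (\<tau> i) T" for i
  proof -
    have "(\<Sum>j=1..2 * m - k. monom (\<eta>' (i + 1) j) (k - 1 + j)) =
        (\<Sum>j\<in>{1, 2}. monom (\<eta>' (i + 1) j) (k - 1 + j))"
      by (intro sum.mono_neutral_right) (auto simp: \<eta>'_def k_def l)
    then show ?thesis
      by (simp add: \<eta>'_def T_def k_def l smult_add_right smult_monom mult_ac numeral_2_eq_2 numeral_3_eq_3)
  qed
  then have "tgrs_polys (2 * m) k \<eta>' = S1"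
    by (simp only: tgrs_polys_def S1_P P_def E_def smult_add_right sum.distrib smult_monom mult_1_right)
  then have "is_tgrs_code \<alpha> v k C1"
    using inj v_nz l n C1 by (auto simp: is_tgrs_code_def k_def)
  with code orth show ?thesis
    by (simp add: n k_def m_def[symmetric])
qed

end
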